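(* Let $\mathbb{F}_q$ be a finite field, let $f\in\mathbb{F}_q[x]$ be a nonzero monic polynomial, and let $D=\{f_1,f_2,\ldots,f_k\}$ ($k\ge 1$) be a set of monic divisors of $f$ with $f\notin D$. Suppose that (1) $\gcd(f_1,f_2,\ldots,f_k)=1$, and (2) the unitary Cayley graph $G_f(\{1\})$ is connected. Then the gcd-graph $G_f(D)$ is connected.
   Context: All polynomials are monic unless stated otherwise and gcd's are taken monic (so $\gcd(0,f)=f$). For a nonzero monic $f\in\mathbb{F}_q[x]$ and a set $D$ of monic divisors of $f$ with $f\notin D$, the gcd-graph $G_f(D)$ is the undirected loopless graph with vertex set the ring $\mathbb{F}_q[x]/(f)$ in which two vertices $u,v$ are adjacent if and only if $\gcd(u-v,f)\in D$. In particular $G_f(\{1\})$ is the unitary Cayley graph of $\mathbb{F}_q[x]/(f)$: $u,v$ are adjacent iff $u-v$ is a unit. *)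

theory Defs
  imports
    "HOL-Computational_Algebra.Computational_Algebra"
    "HOL-Number_Theory.Cong"
    "Graph_Theory.Graph_Theory"
begin

text \<open>
  A finite field is a type of sort \<open>{finite, field_gcd}\<close>. The class \<open>field_gcd\<close>
  puts no restriction on the field: it adds the trivial normalisation structure that a field carries
  (every non-zero element normalises to \<open>1\<close>), and this is what makes the gcd's of the
  library on polynomials over the field the monic ones.
\<close>

lemma gcd_poly_monic:
  fixes p f :: "'a :: field_gcd poly"
  assumes "f \<noteq> 0"
  shows "lead_coeff (gcd p f) = 1"
proof -
  have "gcd p f \<noteq> 0" using assms by simp
  then have "unit_factor (gcd p f) = 1" by (simp add: unit_factor_gcd)
  then have "unit_factor (lead_coeff (gcd p f)) = 1"
    by (simp add: unit_factor_poly_def one_pCons)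
  moreover have "lead_coeff (gcd p f) dvd 1"
    using \<open>gcd p f \<noteq> 0\<close> by (simp add: dvd_field_iff)
  ultimately show ?thesis by (simp add: is_unit_unit_factor)
qed

definition cong_rel :: "'a :: field_gcd poly \<Rightarrow> 'a poly rel" where
  "cong_rel f = {(u, v). [u = v] (mod f)}"

text \<open>
  Vertices are the residue classes modulo \<open>f\<close>. The gcd does not depend on the chosen
  representatives (see \<open>gcd_graph_adj_iff\<close> below). The undirected graph is
  represented, as usual in the graph library, by its symmetric set of arcs
  (see \<open>pair_graph_gcd_graph\<close> below).
\<close>

definition gcd_graph :: "'a :: field_gcd poly \<Rightarrow> 'a poly set \<Rightarrow> 'a poly set pair_pre_digraph" where
  "gcd_graph f D =
    \<lparr>pverts = UNIV // cong_rel f,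
     parcs = {(cong_rel f `` {u}, cong_rel f `` {v}) | u v. gcd (u - v) f \<in> D}\<rparr>"

lemma equiv_cong_rel: "equiv UNIV (cong_rel f)"
  by (rule equivI) (auto simp: cong_rel_def refl_on_def sym_def trans_def cong_def)

lemma cong_rel_class_eq_iff: "cong_rel f `` {u} = cong_rel f `` {v} \<longleftrightarrow> [u = v] (mod f)"
  using eq_equiv_class_iff[OF equiv_cong_rel, of u v] by (simp add: cong_rel_def)

lemma gcd_graph_adj_iff:
  "(cong_rel f `` {u}, cong_rel f `` {v}) \<in> parcs (gcd_graph f D) \<longleftrightarrow> gcd (u - v) f \<in> D"
proof
  assume "(cong_rel f `` {u}, cong_rel f `` {v}) \<in> parcs (gcd_graph f D)"
  then obtain u' v' where *: "[u = u'] (mod f)" "[v = v'] (mod f)" "gcd (u' - v') f \<in> D"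
    by (auto simp: gcd_graph_def cong_rel_class_eq_iff)
  then have "[u - v = u' - v'] (mod f)" by (intro cong_diff)
  then have "gcd (u - v) f = gcd (u' - v') f" by (rule cong_gcd_eq)
  with * show "gcd (u - v) f \<in> D" by simp
qed (auto simp: gcd_graph_def)

lemma unitary_adj_iff:
  "(cong_rel f `` {u}, cong_rel f `` {v}) \<in> parcs (gcd_graph f {1})
    \<longleftrightarrow> (\<exists>w. [(u - v) * w = 1] (mod f))"
proof -
  have "(\<exists>w. [(u - v) * w = 1] (mod f))" if gcd_1: "gcd (u - v) f = 1"
  proof -
    obtain x y where "x * (u - v) + y * f = 1"
      using bezout_coefficients[OF prod.collapse[symmetric], of "u - v" f] gcd_1 by simp
    then have "(u - v) * x - 1 = f * (- y)" by (simp add: algebra_simps)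
    then show ?thesis by (auto simp: cong_iff_dvd_diff intro!: exI[of _ x])
  qed
  moreover have "gcd (u - v) f = 1" if "[(u - v) * w = 1] (mod f)" for w
  proof -
    have "coprime ((u - v) * w) f"
      using cong_gcd_eq[OF that] by (simp add: coprime_iff_gcd_eq_1)
    then have "coprime (u - v) f" by (simp only: coprime_mult_left_iff)
    then show ?thesis by (simp only: coprime_iff_gcd_eq_1)
  qed
  ultimately show ?thesis by (auto simp: gcd_graph_adj_iff)
qed

lemma finite_verts_gcd_graph:
  fixes f :: "'a :: {finite, field_gcd} poly"
  assumes "f \<noteq> 0"
  shows "finite (pverts (gcd_graph f D))"
proof -
  let ?L = "{xs :: 'a list. set xs \<subseteq> UNIV \<and> length xs \<le> Suc (degree f)}"
  have "X \<in> (\<lambda>xs. cong_rel f `` {Poly xs}) ` ?L" if X: "X \<in> pverts (gcd_graph f D)" for X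
  proof -
    from X obtain u where u: "X = cong_rel f `` {u}"
      by (auto simp: gcd_graph_def quotient_def)
    have "length (coeffs (u mod f)) \<le> Suc (degree f)"
      using degree_mod_less[OF assms, of u]
      by (cases "u mod f = 0") (auto simp: length_coeffs_degree)
    moreover have "X = cong_rel f `` {u mod f}"
      unfolding u cong_rel_class_eq_iff by (simp add: cong_def)
    ultimately show ?thesis
      by (intro image_eqI[of _ _ "coeffs (u mod f)"]) auto
  qed
  then have "pverts (gcd_graph f D) \<subseteq> (\<lambda>xs. cong_rel f `` {Poly xs}) ` ?L"
    by (rule subsetI)
  moreover have "finite ?L" by (rule finite_lists_length_le) (rule finite)
  ultimately show ?thesis by (rule finite_subset[OF _ finite_imageI])
qed

lemma pair_graph_gcd_graph:
  fixes f :: "'a :: {finite, field_gcd} poly"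
  assumes "lead_coeff f = 1" and "f \<notin> D"
  shows "pair_graph (gcd_graph f D)"
proof -
  let ?G = "gcd_graph f D"
  have f0: "f \<noteq> 0" using assms(1) by auto
  have sub: "parcs ?G \<subseteq> pverts ?G \<times> pverts ?G"
    by (auto simp: gcd_graph_def intro: quotientI)
  have fin: "finite (pverts ?G)" using f0 by (rule finite_verts_gcd_graph)
  have loop: "fst e \<noteq> snd e" if "e \<in> parcs ?G" for e
  proof
    assume eq: "fst e = snd e"
    from that obtain u v where e: "e = (cong_rel f `` {u}, cong_rel f `` {v})" and "gcd (u - v) f \<in> D"
      by (auto simp: gcd_graph_def)
    have "(cong_rel f `` {u}, cong_rel f `` {u}) \<in> parcs ?G"
      using that eq unfolding e by simp
    then have "gcd (u - u) f \<in> D"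
      by (simp only: gcd_graph_adj_iff)
    moreover have "unit_factor f = 1"
      using assms(1) by (simp add: unit_factor_poly_def is_unit_unit_factor one_pCons)
    then have "normalize f = f"
      using unit_factor_mult_normalize[of f] by simp
    ultimately show False using assms(2) by simp
  qed
  have sy: "symmetric (with_proj ?G)"
    unfolding symmetric_def with_proj_simps
  proof (rule symI)
    fix X Y assume "(X, Y) \<in> parcs ?G"
    then obtain u v where "X = cong_rel f `` {u}" "Y = cong_rel f `` {v}" "gcd (u - v) f \<in> D"
      by (auto simp: gcd_graph_def)
    moreover have "gcd (v - u) f = gcd (u - v) f"
      using gcd_neg1[of "u - v" f] by simp
    ultimately show "(Y, X) \<in> parcs ?G"
      by (simp add: gcd_graph_adj_iff)
  qed
  show ?thesis
  proof unfold_locales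
    show "fst e \<in> pverts ?G" "snd e \<in> pverts ?G" if "e \<in> parcs ?G" for e
      using that sub by (auto simp: mem_Times_iff)
    show "finite (parcs ?G)"
      using sub fin by (rule finite_subset[OF _ finite_cartesian_product]) (rule fin)
  qed (fact fin loop sy)+
qed

end

theory Submission
  imports Defs
begin

text \<open>
  The gcd-graph is the Cayley graph of the additive group of residues modulo \<open>f\<close> whose connection
  set consists of the residues \<open>s\<close> with \<open>gcd s f \<in> D\<close>, so it is connected exactly when these
  residues generate the group (\<open>connected_gcd_graph_iff\<close>). For \<open>D = {1}\<close> the connection set is the
  group of units, so connectedness of the unitary Cayley graph says that every residue is a signed
  sum of units.

  Multiplying a unit by a divisor \<open>g \<in> D\<close> of \<open>f\<close> gives a residue whose gcd with \<open>f\<close> is again \<open>g\<close>.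
  Hence the subgroup generated by the connection set for \<open>D\<close> contains \<open>g\<close> times every signed sum of
  units, that is, the whole ideal generated by \<open>g\<close>
  (\<open>mult_divisor_in_group_closure\<close>). It therefore contains the ideal generated by \<open>D\<close>, and by
  Bezout's identity (\<open>Gcd_finite_bezout\<close>) this ideal is the whole ring, as \<open>Gcd D = 1\<close>.
\<close>

text \<open>
  Working with polynomials rather than residue classes, the multiples of \<open>f\<close> join the generators:
  they account for the choice of representatives.
\<close>

definition gcd_generators :: "'a :: field_gcd poly \<Rightarrow> 'a poly set \<Rightarrow> 'a poly set" where
  "gcd_generators f D = {p. f dvd p} \<union> {p. gcd p f \<in> D}"

lemma verts_gcd_graph: "pverts (gcd_graph f D) = range (\<lambda>u. cong_rel f `` {u})"
  by (auto simp: gcd_graph_def quotient_def)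

lemma symcl_gcd_graph_iff:
  "(cong_rel f `` {u}, cong_rel f `` {v}) \<in> (parcs (gcd_graph f D))\<^sup>s \<longleftrightarrow> gcd (v - u) f \<in> D"
proof -
  have "gcd (u - v) f = gcd (v - u) f"
    using gcd_neg1[of "v - u" f] by simp
  then show ?thesis
    by (auto simp: symcl_def gcd_graph_adj_iff image_iff Bex_def)
qed

text \<open>
  Both implications hold because adjacency depends only on the difference of the endpoints: the
  steps of a walk add up to an element of the generated subgroup, and conversely the elements by
  which every vertex may be translated within its component form a subgroup.
\<close>

lemma connected_gcd_graph_iff:
  "Digraph_Component.connected (with_proj (gcd_graph f D))
    \<longleftrightarrow> group_closure (gcd_generators f D) = UNIV"
proof -
  let ?c = "\<lambda>u. cong_rel f `` {u}"
  let ?H = "group_closure (gcd_generators f D)"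
  define K where "K = rtrancl_on (pverts (gcd_graph f D)) ((parcs (gcd_graph f D))\<^sup>s)"
  have vert: "?c u \<in> pverts (gcd_graph f D)" for u
    by (simp add: verts_gcd_graph)
  have conn: "Digraph_Component.connected (with_proj (gcd_graph f D)) \<longleftrightarrow> (\<forall>u v. (?c u, ?c v) \<in> K)"
    by (auto simp: connected_conv K_def verts_gcd_graph)
  \<comment> \<open>The endpoint has no preferred representative, so the induction treats all of them at once.\<close>
  have walk: "\<forall>w. Y = ?c w \<longrightarrow> w - u \<in> ?H" if "(?c u, Y) \<in> K" for u Y
    using that unfolding K_def
  proof (induction rule: rtrancl_on_induct)
    case base
    have "w - u \<in> ?H" if "?c u = ?c w" for w
    proof -
      have "f dvd w - u"
        using that by (simp add: cong_rel_class_eq_iff cong_iff_dvd_diff dvd_diff_commute)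
      then show ?thesis by (intro group_closure.base) (simp add: gcd_generators_def)
    qed
    then show ?case by blast
  next
    case (step X Z)
    show ?case
    proof (intro allI impI)
      fix w assume Z: "Z = ?c w"
      from step obtain x where X: "X = ?c x" by (auto simp: verts_gcd_graph)
      have "gcd (w - x) f \<in> D"
        using step.hyps(2) unfolding X Z symcl_gcd_graph_iff .
      then have "w - x \<in> ?H" by (intro group_closure.base) (simp add: gcd_generators_def)
      moreover have "x - u \<in> ?H" using step.IH X by blast
      ultimately have "(w - x) + (x - u) \<in> ?H" by (rule group_closure_add)
      then show "w - u \<in> ?H" by simp
    qed
  qed
  have sym: "sym K"
    unfolding K_def by (rule rtrancl_on_sym) (auto simp: sym_def symcl_def)
  have translate: "(?c u, ?c (u + p)) \<in> K" if "p \<in> ?H" for u p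
    using that
  proof (induction arbitrary: u rule: group_closure.induct)
    case (base s)
    then consider "f dvd s" | "gcd s f \<in> D" by (auto simp: gcd_generators_def)
    then show ?case
    proof cases
      case 1
      then have "?c u = ?c (u + s)"
        by (simp add: cong_rel_class_eq_iff cong_iff_dvd_diff)
      then show ?thesis using vert[of u] by (simp add: K_def)
    next
      case 2
      then have "(?c u, ?c (u + s)) \<in> (parcs (gcd_graph f D))\<^sup>s"
        by (simp add: symcl_gcd_graph_iff)
      then show ?thesis
        using vert unfolding K_def by (blast intro: rtrancl_on_into_rtrancl_on)
    qed
  next
    case (diff s t)
    have "(?c u, ?c (u + s)) \<in> K" by (rule diff.IH)
    moreover have "(?c (u + s - t), ?c (u + s)) \<in> K"
      using diff.IH(2)[of "u + s - t"] by simp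
    then have "(?c (u + s), ?c (u + s - t)) \<in> K" using sym by (blast dest: symD)
    ultimately have "(?c u, ?c (u + s - t)) \<in> K"
      unfolding K_def by (rule rtrancl_on_trans)
    then show ?case by (simp add: add_diff_eq)
  qed
  show ?thesis
  proof
    assume "Digraph_Component.connected (with_proj (gcd_graph f D))"
    then have "p - 0 \<in> ?H" for p using conn walk[of 0 "?c p"] by blast
    then show "?H = UNIV" by auto
  next
    assume "?H = UNIV"
    then have "(?c u, ?c (u + (v - u))) \<in> K" for u v by (intro translate) simp
    then show "Digraph_Component.connected (with_proj (gcd_graph f D))" by (simp add: conn)
  qed
qed

lemma Gcd_finite_bezout:
  fixes A :: "'a :: euclidean_ring_gcd set"
  assumes "finite A"
  shows "\<exists>c. (\<Sum>a\<in>A. c a * a) = Gcd A"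
  using assms
proof (induction A)
  case empty
  show ?case by simp
next
  case (insert a A)
  then obtain c where c: "(\<Sum>b\<in>A. c b * b) = Gcd A" by blast
  obtain x y where xy: "x * a + y * Gcd A = gcd a (Gcd A)"
    using bezout_coefficients_fst_snd by blast
  let ?c = "(\<lambda>b. y * c b)(a := x)"
  have "(\<Sum>b\<in>A. ?c b * b) = (\<Sum>b\<in>A. y * (c b * b))"
    using insert.hyps by (intro sum.cong) (auto simp: mult.assoc)
  also have "\<dots> = y * Gcd A" by (simp add: c flip: sum_distrib_left)
  finally have "(\<Sum>b\<in>insert a A. ?c b * b) = Gcd (insert a A)"
    using insert.hyps xy by simp
  then show ?case by blast
qed

lemma sum_in_group_closure:
  "(\<And>a. a \<in> A \<Longrightarrow> h a \<in> group_closure S) \<Longrightarrow> sum h A \<in> group_closure S"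
  by (induction A rule: infinite_finite_induct) (auto intro: group_closure_add)

text \<open>
  Multiplication by \<open>g\<close> maps the generators for \<open>{1}\<close> to generators for \<open>D\<close>, because a factor coprime
  to \<open>f\<close> does not change the gcd with \<open>f\<close>; being additive, it maps the generated subgroups
  accordingly.
\<close>

lemma mult_divisor_in_group_closure:
  fixes f g :: "'a :: field_gcd poly"
  assumes "lead_coeff g = 1" and "g dvd f" and "g \<in> D"
    and units: "group_closure (gcd_generators f {1}) = UNIV"
  shows "g * p \<in> group_closure (gcd_generators f D)"
proof -
  have "unit_factor g = 1"
    using assms(1) by (simp add: unit_factor_poly_def is_unit_unit_factor one_pCons)
  then have "normalize g = g"
    using unit_factor_mult_normalize[of g] by simp
  then have "gcd g f = g"
    using gcd_proj1_if_dvd[OF assms(2)] by simp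
  then have "gcd (g * s) f = g" if "gcd s f = 1" for s
    using that gcd_mult_left_right_cancel[of f s g]
    by (simp add: coprime_iff_gcd_eq_1 gcd.commute)
  then have generators: "times g ` gcd_generators f {1} \<subseteq> gcd_generators f D"
    using assms(3) by (auto simp: gcd_generators_def)
  have "group_closure (times g ` gcd_generators f {1}) \<subseteq> group_closure (gcd_generators f D)"
  proof
    fix x assume "x \<in> group_closure (times g ` gcd_generators f {1})"
    then show "x \<in> group_closure (gcd_generators f D)"
      by induction (use generators in \<open>auto intro: group_closure.intros\<close>)
  qed
  then show ?thesis by (auto simp: group_closure_mult_all_eq units)
qed

theorem theorem3p2:
  fixes f :: "'a :: {finite, field_gcd} poly" and D :: "'a poly set"
  assumes "lead_coeff f = 1"
    and "finite D" and "D \<noteq> {}"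
    and "\<forall>g\<in>D. lead_coeff g = 1 \<and> g dvd f"
    and "f \<notin> D"
    and "Gcd D = 1"
    and "Digraph_Component.connected (with_proj (gcd_graph f {1}))"
  shows "Digraph_Component.connected (with_proj (gcd_graph f D))"
proof -
  obtain c where c: "(\<Sum>g\<in>D. c g * g) = 1"
    using Gcd_finite_bezout[OF \<open>finite D\<close>] \<open>Gcd D = 1\<close> by auto
  have units: "group_closure (gcd_generators f {1}) = UNIV"
    using assms(7) by (simp only: connected_gcd_graph_iff)
  have "p \<in> group_closure (gcd_generators f D)" for p
  proof -
    have "(\<Sum>g\<in>D. g * (c g * p)) \<in> group_closure (gcd_generators f D)"
      using assms(4) units by (blast intro: sum_in_group_closure mult_divisor_in_group_closure)
    also have "(\<Sum>g\<in>D. g * (c g * p)) = (\<Sum>g\<in>D. c g * g) * p"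
      by (simp add: sum_distrib_left mult_ac)
    finally show ?thesis by (simp add: c)
  qed
  then show ?thesis by (auto simp: connected_gcd_graph_iff)
qed

end
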